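(* Let $\mathbf{C}=\mathbb{C}[\![x_1,\dots,x_m]\!]$ with its involution $*$, and let $A\in\operatorname{Mat}_n(\mathbf{C})$ be a normal matrix. Let $\lambda_1,\dots,\lambda_d$ be the distinct eigenvalues of $A$ in an algebraic closure $\mathbb{F}$ of $\operatorname{Frac}(\mathbf{C})$. Then $A$ is unitarily diagonalizable over $\mathbf{C}$ (i.e. there exist a unitary matrix $U\in\mathbb{U}_n(\mathbf{C})$ and a diagonal matrix $D\in\operatorname{Mat}_n(\mathbf{C})$ with $A=UDU^*$) if and only if the following holds: the characteristic polynomial of $A$ splits totally into linear factors over $\mathbf{C}$ (so $\lambda_1,\dots,\lambda_d\in\mathbf{C}$), and all the matrix entries of the projection operators onto the eigenspaces of $A$ belong to $\mathbf{C}$, i.e. there exist matrices $\Pi_1,\dots,\Pi_d\in\operatorname{Mat}_n(\mathbf{C})$ such that $$\Pi_k^*=\Pi_k,\quad \Pi_k^2=\Pi_k,\quad \sum_{k=1}^d\Pi_k=I_n,\quad \Pi_k\Pi_{k'}=0\ \text{ if } k\neq k',$$ and $A=\sum_{k=1}^d\lambda_k\Pi_k$.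
   Context: $\mathbf{C}=\mathbb{C}[\![x_1,\dots,x_m]\!]$ is the ring of formal power series in $m$ variables over $\mathbb{C}$. The involution $*$ on $\mathbf{C}$ acts by complex conjugation on coefficients and fixes each variable: $c^*=\bar c$ for $c\in\mathbb{C}$ and $x_i^*=x_i$. For $A=(a_{ij})\in\operatorname{Mat}_n(\mathbf{C})$, the adjoint is $A^*=(a_{ji}^* )_{i,j}$. $A$ is normal if $AA^*=A^*A$. $U\in\operatorname{Mat}_n(\mathbf{C})$ is unitary if $UU^*=U^*U=I_n$; $\mathbb{U}_n(\mathbf{C})$ denotes the group of unitary matrices. Eigenvalues of $A$ are the roots of its characteristic polynomial in an algebraic closure of $\operatorname{Frac}(\mathbf{C})$. *)

theory Defs
  imports
    "Jordan_Normal_Form.Char_Poly"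
    "Jordan_Normal_Form.Conjugate"
    "HOL-Library.Poly_Mapping"
    "HOL-Library.Countable"
    "HOL-Algebra.Algebraic_Closure_Type"
begin

section \<open>Formal power series in several variables\<close>

text \<open>
  The type \<open>('a, 'v) mfps\<close> is the ring of formal power series with coefficients in \<open>'a\<close> whose
  variables are the elements of \<open>'v\<close>; monomials are the finitely supported exponent vectors
  \<open>'v \<Rightarrow>\<^sub>0 nat\<close>.  For a finite type \<open>'v\<close> with \<open>m\<close> elements this is the ring of power series
  in \<open>m\<close> variables.
\<close>

typedef ('a, 'v) mfps = "UNIV :: (('v \<Rightarrow>\<^sub>0 nat) \<Rightarrow> 'a) set"
  morphisms mfps_nth Abs_mfps ..

setup_lifting type_definition_mfps

lemma mfps_eqI: "(\<And>e. mfps_nth f e = mfps_nth g e) \<Longrightarrow> f = g"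
  by transfer auto

abbreviation splittings :: "('v \<Rightarrow>\<^sub>0 nat) \<Rightarrow> (('v \<Rightarrow>\<^sub>0 nat) \<times> ('v \<Rightarrow>\<^sub>0 nat)) set" where
  "splittings e \<equiv> {(a, b). a + b = e}"

lemma finite_splittings: "finite (splittings (e :: 'v \<Rightarrow>\<^sub>0 nat))"
proof -
  define B where "B = {..Max (insert 0 (Poly_Mapping.lookup e ` Poly_Mapping.keys e))}"
  define F where "F = {f :: 'v \<Rightarrow> nat. \<forall>x. (x \<in> Poly_Mapping.keys e \<longrightarrow> f x \<in> B) \<and> (x \<notin> Poly_Mapping.keys e \<longrightarrow> f x = 0)}"
  have finF: "finite F"
    unfolding F_def by (rule finite_set_of_finite_funs) (auto simp: B_def)
  have le: "Poly_Mapping.lookup a \<in> F" if "\<And>x. Poly_Mapping.lookup a x \<le> Poly_Mapping.lookup e x" for a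
  proof -
    have "Poly_Mapping.lookup a x \<le> Max (insert 0 (Poly_Mapping.lookup e ` Poly_Mapping.keys e))" if "x \<in> Poly_Mapping.keys e" for x
      by (rule order.trans[OF \<open>\<And>x. Poly_Mapping.lookup a x \<le> Poly_Mapping.lookup e x\<close>]) (use that in auto)
    moreover have "Poly_Mapping.lookup a x = 0" if "x \<notin> Poly_Mapping.keys e" for x
      using \<open>\<And>x. Poly_Mapping.lookup a x \<le> Poly_Mapping.lookup e x\<close>[of x] that by (simp add: in_keys_iff)
    ultimately show ?thesis by (auto simp: F_def B_def)
  qed
  have fin: "finite (Poly_Mapping.lookup -` F)"
    by (rule finite_vimageI[OF finF]) (auto intro: injI poly_mapping_eqI)
  have "splittings e \<subseteq> (Poly_Mapping.lookup -` F) \<times> (Poly_Mapping.lookup -` F)"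
    by (auto intro!: le simp: lookup_add)
  thus ?thesis
    by (rule finite_subset) (use fin in auto)
qed

instantiation mfps :: (comm_ring_1, type) comm_ring_1
begin

lift_definition zero_mfps :: "('a, 'b) mfps" is "\<lambda>_. 0" .

lift_definition one_mfps :: "('a, 'b) mfps" is "\<lambda>e. if e = 0 then 1 else 0" .

lift_definition plus_mfps :: "('a, 'b) mfps \<Rightarrow> ('a, 'b) mfps \<Rightarrow> ('a, 'b) mfps"
  is "\<lambda>f g e. f e + g e" .

lift_definition minus_mfps :: "('a, 'b) mfps \<Rightarrow> ('a, 'b) mfps \<Rightarrow> ('a, 'b) mfps"
  is "\<lambda>f g e. f e - g e" .

lift_definition uminus_mfps :: "('a, 'b) mfps \<Rightarrow> ('a, 'b) mfps"
  is "\<lambda>f e. - f e" .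

lift_definition times_mfps :: "('a, 'b) mfps \<Rightarrow> ('a, 'b) mfps \<Rightarrow> ('a, 'b) mfps"
  is "\<lambda>f g e. \<Sum>(a, b)\<in>splittings e. f a * g b" .

instance
proof
  fix f g h :: "('a, 'b) mfps"
  show "f + g + h = f + (g + h)" by transfer (simp add: add.assoc)
  show "f + g = g + f" by transfer (simp add: add.commute)
  show "0 + f = f" by transfer simp
  show "- f + f = 0" by transfer simp
  show "f - g = f + - g" by transfer simp
  show "(f + g) * h = f * h + g * h"
    by transfer (simp add: distrib_right sum.distrib case_prod_unfold)
  show "f * g = g * f"
  proof (transfer, rule ext)
    fix f g :: "('b \<Rightarrow>\<^sub>0 nat) \<Rightarrow> 'a" and e
    show "(\<Sum>(a, b)\<in>splittings e. f a * g b) = (\<Sum>(a, b)\<in>splittings e. g a * f b)"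
      by (rule sum.reindex_bij_witness[of _ prod.swap prod.swap])
        (auto simp: add.commute mult.commute)
  qed
  show "1 * f = f"
  proof (transfer, rule ext)
    fix f :: "('b \<Rightarrow>\<^sub>0 nat) \<Rightarrow> 'a" and e
    have "(\<Sum>(a, b)\<in>splittings e. (if a = 0 then 1 else 0) * f b)
        = (\<Sum>(a, b)\<in>{(0 :: 'b \<Rightarrow>\<^sub>0 nat, e)}. (if a = 0 then 1 else 0) * f b)"
      by (rule sum.mono_neutral_right) (auto simp: finite_splittings split: if_splits)
    thus "(\<Sum>(a, b)\<in>splittings e. (if a = 0 then 1 else 0) * f b) = f e" by simp
  qed
  show "f * g * h = f * (g * h)"
  proof (transfer, rule ext)
    fix f g h :: "('b \<Rightarrow>\<^sub>0 nat) \<Rightarrow> 'a" and e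
    have "(\<Sum>(u, c)\<in>splittings e. (\<Sum>(a, b)\<in>splittings u. f a * g b) * h c)
        = (\<Sum>p\<in>splittings e. \<Sum>q\<in>splittings (fst p). f (fst q) * g (snd q) * h (snd p))"
      by (simp add: case_prod_unfold sum_distrib_right)
    also have "\<dots> = (\<Sum>(p, q)\<in>(SIGMA p:splittings e. splittings (fst p)).
        f (fst q) * g (snd q) * h (snd p))"
      by (rule sum.Sigma) (auto simp: finite_splittings)
    also have "\<dots> = (\<Sum>(p, q)\<in>(SIGMA p:splittings e. splittings (snd p)).
        f (fst p) * (g (fst q) * h (snd q)))"
      by (rule sum.reindex_bij_witness[of _
            "\<lambda>(p, q). ((fst p + fst q, snd q), (fst p, fst q))"
            "\<lambda>(p, q). ((fst q, snd q + snd p), (snd q, snd p))"])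
        (auto simp: add.assoc mult.assoc)
    also have "\<dots> = (\<Sum>p\<in>splittings e. \<Sum>q\<in>splittings (snd p).
        f (fst p) * (g (fst q) * h (snd q)))"
      by (rule sum.Sigma[symmetric]) (auto simp: finite_splittings)
    also have "\<dots> = (\<Sum>(a, u)\<in>splittings e. f a * (\<Sum>(b, c)\<in>splittings u. g b * h c))"
      by (simp add: case_prod_unfold sum_distrib_left)
    finally show "(\<Sum>(u, c)\<in>splittings e. (\<Sum>(a, b)\<in>splittings u. f a * g b) * h c)
        = (\<Sum>(a, u)\<in>splittings e. f a * (\<Sum>(b, c)\<in>splittings u. g b * h c))" .
  qed
  show "(0 :: ('a, 'b) mfps) \<noteq> 1"
  proof
    assume eq: "(0 :: ('a, 'b) mfps) = 1"
    have "mfps_nth (0 :: ('a, 'b) mfps) 0 = mfps_nth (1 :: ('a, 'b) mfps) 0"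
      by (simp only: eq)
    thus False
      by (simp add: zero_mfps.rep_eq one_mfps.rep_eq)
  qed
qed

end

lemma mfps_nth_mult:
  "mfps_nth (f * g) e = (\<Sum>(a, b)\<in>splittings e. mfps_nth f a * mfps_nth g b)"
  by (simp only: times_mfps.rep_eq)

text \<open>
  Absence of zero divisors: among the monomials of least total degree, take the one that is least
  in a lexicographic order on exponent vectors.
\<close>

definition tdeg :: "('v :: finite \<Rightarrow>\<^sub>0 nat) \<Rightarrow> nat" where
  "tdeg e = (\<Sum>i\<in>UNIV. Poly_Mapping.lookup e i)"

definition lexkey :: "('v :: finite \<Rightarrow>\<^sub>0 nat) \<Rightarrow> (nat \<Rightarrow>\<^sub>0 nat)" where
  "lexkey e = (\<Sum>i\<in>UNIV. Poly_Mapping.single (to_nat i) (Poly_Mapping.lookup e i))"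

lemma tdeg_add: "tdeg (a + b) = tdeg a + tdeg b"
  by (simp add: tdeg_def lookup_add sum.distrib)

lemma lexkey_add: "lexkey (a + b) = lexkey a + lexkey b"
  by (simp add: lexkey_def lookup_add single_add sum.distrib)

lemma lookup_lexkey: "Poly_Mapping.lookup (lexkey e) (to_nat i) = Poly_Mapping.lookup e i"
proof -
  have "Poly_Mapping.lookup (lexkey e) (to_nat i) = (\<Sum>j\<in>UNIV. if j = i then Poly_Mapping.lookup e i else 0)"
    unfolding lexkey_def lookup_sum
    by (rule sum.cong) (auto simp: lookup_single when_def)
  thus ?thesis by simp
qed

lemma inj_lexkey:
  fixes a b :: "'v :: finite \<Rightarrow>\<^sub>0 nat"
  assumes "lexkey a = lexkey b"
  shows "a = b"
proof (rule poly_mapping_eqI)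
  fix i :: 'v
  have "Poly_Mapping.lookup (lexkey a) (to_nat i) = Poly_Mapping.lookup (lexkey b) (to_nat i)"
    by (simp only: assms)
  thus "Poly_Mapping.lookup a i = Poly_Mapping.lookup b i"
    by (simp only: lookup_lexkey)
qed

lemma finite_tdeg: "finite {e :: 'v :: finite \<Rightarrow>\<^sub>0 nat. tdeg e = d}"
proof -
  have "Poly_Mapping.lookup e i \<le> tdeg e" for e :: "'v \<Rightarrow>\<^sub>0 nat" and i
    unfolding tdeg_def by (rule member_le_sum) auto
  hence "Poly_Mapping.lookup ` {e :: 'v \<Rightarrow>\<^sub>0 nat. tdeg e = d} \<subseteq> {f. \<forall>x. (x \<in> UNIV \<longrightarrow> f x \<in> {..d}) \<and> (x \<notin> UNIV \<longrightarrow> f x = 0)}"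
    by auto
  hence "finite (Poly_Mapping.lookup ` {e :: 'v \<Rightarrow>\<^sub>0 nat. tdeg e = d})"
    by (rule finite_subset) (rule finite_set_of_finite_funs, auto)
  thus ?thesis
    by (rule finite_imageD) (simp add: inj_on_def poly_mapping.lookup_inject)
qed

lemma mfps_leading_exponent:
  fixes f :: "('a :: comm_ring_1, 'v :: finite) mfps"
  assumes "f \<noteq> 0"
  obtains e where "mfps_nth f e \<noteq> 0"
    and "\<And>a. mfps_nth f a \<noteq> 0 \<Longrightarrow> tdeg e \<le> tdeg a"
    and "\<And>a. mfps_nth f a \<noteq> 0 \<Longrightarrow> tdeg a = tdeg e \<Longrightarrow> lexkey e \<le> lexkey a"
proof -
  have "\<exists>e. mfps_nth f e \<noteq> 0"
    using assms by (metis mfps_eqI zero_mfps.rep_eq)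
  then obtain e0 where e0: "mfps_nth f e0 \<noteq> 0"
    and min: "\<And>a. mfps_nth f a \<noteq> 0 \<Longrightarrow> tdeg e0 \<le> tdeg a"
    using ex_has_least_nat[of "\<lambda>e. mfps_nth f e \<noteq> 0" _ tdeg] by blast
  define S where "S = {e. mfps_nth f e \<noteq> 0 \<and> tdeg e = tdeg e0}"
  have fin: "finite S"
    unfolding S_def by (rule finite_subset[OF _ finite_tdeg[of "tdeg e0"]]) auto
  have "e0 \<in> S" by (simp add: S_def e0)
  hence "Min (lexkey ` S) \<in> lexkey ` S"
    using fin by (intro Min_in) auto
  then obtain e where e: "e \<in> S" "lexkey e = Min (lexkey ` S)" by auto
  have "lexkey e \<le> lexkey a" if "a \<in> S" for a
    using that fin e(2) by simp
  thus ?thesis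
    using that[of e] e(1) min by (auto simp: S_def)
qed

instance mfps :: (idom, finite) idom
proof
  fix f g :: "('a, 'b) mfps"
  assume "f \<noteq> 0" "g \<noteq> 0"
  obtain u where u: "mfps_nth f u \<noteq> 0"
    "\<And>a. mfps_nth f a \<noteq> 0 \<Longrightarrow> tdeg u \<le> tdeg a"
    "\<And>a. mfps_nth f a \<noteq> 0 \<Longrightarrow> tdeg a = tdeg u \<Longrightarrow> lexkey u \<le> lexkey a"
    using mfps_leading_exponent[OF \<open>f \<noteq> 0\<close>] by blast
  obtain v where v: "mfps_nth g v \<noteq> 0"
    "\<And>a. mfps_nth g a \<noteq> 0 \<Longrightarrow> tdeg v \<le> tdeg a"
    "\<And>a. mfps_nth g a \<noteq> 0 \<Longrightarrow> tdeg a = tdeg v \<Longrightarrow> lexkey v \<le> lexkey a"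
    using mfps_leading_exponent[OF \<open>g \<noteq> 0\<close>] by blast
  have "a = u \<and> b = v" if "a + b = u + v" "mfps_nth f a \<noteq> 0" "mfps_nth g b \<noteq> 0" for a b
  proof -
    have "tdeg a + tdeg b = tdeg u + tdeg v"
      using that(1) by (metis tdeg_add)
    with u(2)[OF that(2)] v(2)[OF that(3)] have "tdeg a = tdeg u" "tdeg b = tdeg v" by auto
    hence le: "lexkey u \<le> lexkey a" "lexkey v \<le> lexkey b"
      using u(3) v(3) that by auto
    have eq: "lexkey a + lexkey b = lexkey u + lexkey v"
      using that(1) by (metis lexkey_add)
    have "lexkey a = lexkey u"
    proof (rule ccontr)
      assume "lexkey a \<noteq> lexkey u"
      with le have "lexkey u < lexkey a" by simp
      hence "lexkey u + lexkey v < lexkey a + lexkey b"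
        using le(2) by (rule add_less_le_mono)
      with eq show False by simp
    qed
    with eq have "lexkey b = lexkey v" by simp
    with \<open>lexkey a = lexkey u\<close> show ?thesis by (simp add: inj_lexkey)
  qed
  hence "mfps_nth (f * g) (u + v) = (\<Sum>(a, b)\<in>{(u, v)}. mfps_nth f a * mfps_nth g b)"
    unfolding mfps_nth_mult
    by (intro sum.mono_neutral_right) (auto simp: finite_splittings)
  hence "mfps_nth (f * g) (u + v) \<noteq> 0"
    using u(1) v(1) by simp
  thus "f * g \<noteq> 0"
    by (metis zero_mfps.rep_eq)
qed


section \<open>The involution, normal and unitary matrices\<close>

text \<open>
  The involution conjugates the coefficients and therefore fixes the variables.  On the type
  \<^typ>\<open>complex\<close>, \<^const>\<open>conjugate\<close> is complex conjugation.
\<close>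

instantiation mfps :: (conjugate, type) conjugate
begin

lift_definition conjugate_mfps :: "('a, 'b) mfps \<Rightarrow> ('a, 'b) mfps"
  is "\<lambda>f e. conjugate (f e)" .

instance
proof
  fix f g :: "('a, 'b) mfps"
  show "conjugate (conjugate f) = f"
    by (rule mfps_eqI) (simp only: conjugate_mfps.rep_eq conjugate_id)
  show "conjugate f = conjugate g \<longleftrightarrow> f = g"
  proof
    assume eq: "conjugate f = conjugate g"
    show "f = g"
    proof (rule mfps_eqI)
      fix e
      have "mfps_nth (conjugate f) e = mfps_nth (conjugate g) e"
        by (simp only: eq)
      thus "mfps_nth f e = mfps_nth g e"
        by (simp only: conjugate_mfps.rep_eq conjugate_cancel_iff)
    qed
  qed simp
qed

end

instance mfps :: ("{comm_ring_1, conjugatable_ring}", type) conjugatable_ring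
proof
  fix f g :: "('a, 'b) mfps"
  show "conjugate (f * g) = conjugate f * conjugate g"
  proof (rule mfps_eqI)
    fix e
    have "mfps_nth (conjugate (f * g)) e
        = (\<Sum>p\<in>splittings e. conjugate (mfps_nth f (fst p) * mfps_nth g (snd p)))"
      unfolding conjugate_mfps.rep_eq mfps_nth_mult case_prod_beta
      by (rule sum_conjugate) (use finite_splittings[of e] in \<open>simp only: case_prod_unfold\<close>)
    also have "\<dots> = mfps_nth (conjugate f * conjugate g) e"
      unfolding conjugate_mfps.rep_eq mfps_nth_mult case_prod_beta
      by (simp only: conjugate_dist_mul)
    finally show "mfps_nth (conjugate (f * g)) e = mfps_nth (conjugate f * conjugate g) e" .
  qed
  show "conjugate (f + g) = conjugate f + conjugate g"
    by (rule mfps_eqI) (simp only: conjugate_mfps.rep_eq plus_mfps.rep_eq conjugate_dist_add)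
  show "conjugate (- f) = - conjugate f"
    by (rule mfps_eqI) (simp only: conjugate_mfps.rep_eq uminus_mfps.rep_eq conjugate_neg)
  show "conjugate (0 :: ('a, 'b) mfps) = 0"
    by (rule mfps_eqI) (simp only: conjugate_mfps.rep_eq zero_mfps.rep_eq conjugate_zero)
qed

text \<open>
  The library's \<open>mat_adjoint\<close> is restricted to matrices over fields.
\<close>

definition adjoint_mat :: "'a :: conjugate mat \<Rightarrow> 'a mat" where
  "adjoint_mat A = transpose_mat (map_mat conjugate A)"

definition normal_mat :: "'a :: conjugatable_ring mat \<Rightarrow> bool" where
  "normal_mat A \<longleftrightarrow> A * adjoint_mat A = adjoint_mat A * A"

definition unitary_mat :: "nat \<Rightarrow> 'a :: {conjugatable_ring, one} mat \<Rightarrow> bool" where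
  "unitary_mat n U \<longleftrightarrow>
     U \<in> carrier_mat n n \<and> U * adjoint_mat U = 1\<^sub>m n \<and> adjoint_mat U * U = 1\<^sub>m n"

definition unitarily_diagonalizable :: "nat \<Rightarrow> 'a :: {conjugatable_ring, one} mat \<Rightarrow> bool" where
  "unitarily_diagonalizable n A \<longleftrightarrow>
     (\<exists>U D. unitary_mat n U \<and> D \<in> carrier_mat n n \<and> diagonal_mat D \<and>
        A = U * D * adjoint_mat U)"


section \<open>Eigenvalues in the algebraic closure of the field of fractions\<close>

definition to_closure :: "'a :: idom \<Rightarrow> 'a fract alg_closure" where
  "to_closure x = to_ac (to_fract x)"

definition closure_eigenvalues :: "'a :: idom mat \<Rightarrow> 'a fract alg_closure set" where
  "closure_eigenvalues A = {x. poly (map_poly to_closure (char_poly A)) x = 0}"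

end

theory Submission
  imports Defs
begin

text \<open>
  Given \<open>A = U D U\<^sup>*\<close>, the distinct diagonal entries of \<open>D\<close> are the eigenvalues, and grouping the
  columns of \<open>U\<close> by the value of the diagonal entry gives the projections: \<open>\<Pi>\<^sub>k = U E\<^sub>k U\<^sup>*\<close> where \<open>E\<^sub>k\<close>
  is the diagonal \<open>0\<close>-\<open>1\<close> matrix that marks the positions at which \<open>D\<close> has the entry \<open>\<lambda>\<^sub>k\<close>
  (\<open>spectral_if_unitarily_diagonalizable\<close>).

  Conversely, suppose that orthogonal projections \<open>\<Pi>\<^sub>k\<close> over the power series ring are given. It
  suffices to find an orthonormal basis of the image of each of them: the concatenation of these
  bases is a unitary matrix, and it diagonalizes \<open>A = \<Sum>\<lambda>\<^sub>k \<Pi>\<^sub>k\<close>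
  (\<open>unitarily_diagonalizable_if_spectral\<close>). Over \<open>\<complex>\<close> this is the Gram-Schmidt process. Over
  power series a vector can be normalized when its squared length has an inverse square root, and
  this is so as soon as the constant term of the vector is nonzero: the squared length is then
  self-adjoint with a positive real constant term, and the inverse square root exists by successive
  approximation (\<open>selfadjoint_inverse_sqrt\<close>). Such a vector is available in the image of every
  nonzero projection \<open>P\<close>: if all entries of \<open>P\<close> had constant term zero, then \<open>P = P\<^sup>d\<close> would vanish to
  every order \<open>d\<close> (\<open>idempotent_with_zero_constant_term\<close>), so some column of \<open>P\<close> has a nonzero
  constant term. Splitting off the normalized column \<open>v\<close> leaves the projection \<open>P - v v\<^sup>*\<close>, whose
  trace is smaller by one, and the process stops because the constant term of the trace of a
  projection is nonnegative (\<open>projection_isometry\<close>).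

  Orthonormal families are carried as matrices \<open>V\<close> with \<open>V\<^sup>* V = 1\<close>; then \<open>V V\<^sup>*\<close> is the projection
  onto their span.
\<close>

section \<open>Adjoint matrices\<close>

lemma conjugate_one [simp]: "conjugate (1 :: 'a :: {comm_ring_1, conjugatable_ring}) = 1"
proof -
  have "conjugate (1 :: 'a) = conjugate 1 * conjugate (conjugate 1)"
    by simp
  also have "\<dots> = conjugate (1 * conjugate 1)"
    by (simp only: conjugate_dist_mul)
  finally show ?thesis
    by simp
qed

lemma dim_adjoint [simp]:
  "dim_row (adjoint_mat A) = dim_col A" "dim_col (adjoint_mat A) = dim_row A"
  by (simp_all add: adjoint_mat_def)

lemma index_adjoint [simp]:
  "i < dim_col A \<Longrightarrow> j < dim_row A \<Longrightarrow> adjoint_mat A $$ (i, j) = conjugate (A $$ (j, i))"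
  by (simp add: adjoint_mat_def)

lemma adjoint_carrier [simp]: "A \<in> carrier_mat n m \<Longrightarrow> adjoint_mat A \<in> carrier_mat m n"
  by (rule carrier_matI) auto

lemma adjoint_adjoint [simp]: "adjoint_mat (adjoint_mat A) = A"
  by (rule eq_matI) auto

lemma adjoint_minus:
  fixes A B :: "'a :: conjugatable_ring mat"
  assumes "A \<in> carrier_mat n m" "B \<in> carrier_mat n m"
  shows "adjoint_mat (A - B) = adjoint_mat A - adjoint_mat B"
  by (rule eq_matI)
    (use assms in \<open>auto simp: conjugate_dist_add conjugate_neg simp flip: add_uminus_conv_diff\<close>)

lemma adjoint_mult:
  fixes A B :: "'a :: {comm_ring_1, conjugatable_ring} mat"
  assumes "A \<in> carrier_mat n m" "B \<in> carrier_mat m l"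
  shows "adjoint_mat (A * B) = adjoint_mat B * adjoint_mat A"
  by (rule eq_matI)
    (use assms in \<open>auto simp: scalar_prod_def sum_conjugate conjugate_dist_mul mult.commute\<close>)

lemma adjoint_four_block:
  assumes "A \<in> carrier_mat a c" "B \<in> carrier_mat a d" "C \<in> carrier_mat b c" "D \<in> carrier_mat b d"
  shows "adjoint_mat (four_block_mat A B C D) =
    four_block_mat (adjoint_mat A) (adjoint_mat C) (adjoint_mat B) (adjoint_mat D)"
  by (rule eq_matI) (use assms in auto)

section \<open>Orthonormal families as isometries\<close>

definition isometry_mat :: "nat \<Rightarrow> nat \<Rightarrow> 'a :: {comm_ring_1, conjugatable_ring} mat \<Rightarrow> bool" where
  "isometry_mat n r V \<longleftrightarrow> V \<in> carrier_mat n r \<and> adjoint_mat V * V = 1\<^sub>m r"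

lemma isometry_mat_carrier: "isometry_mat n r V \<Longrightarrow> V \<in> carrier_mat n r"
  by (simp add: isometry_mat_def)

lemma isometry_absorb:
  assumes V: "isometry_mat n r V"
  shows "V * adjoint_mat V * V = V" "adjoint_mat V * (V * adjoint_mat V) = adjoint_mat V"
proof -
  have c: "V \<in> carrier_mat n r" "adjoint_mat V \<in> carrier_mat r n" "adjoint_mat V * V = 1\<^sub>m r"
    using V by (auto simp: isometry_mat_def)
  show "V * adjoint_mat V * V = V"
    using c by (simp add: assoc_mult_mat[OF c(1,2,1)])
  show "adjoint_mat V * (V * adjoint_mat V) = adjoint_mat V"
    using c by (simp flip: assoc_mult_mat[OF c(2,1,2)])
qed

text \<open>
  Two orthonormal families that are orthogonal to each other form one orthonormal family: \<open>U\<close> is the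
  concatenation of the columns of \<open>V\<close> and of \<open>W\<close>. The identity for block diagonal matrices is what
  assembles a diagonal form from diagonal forms on orthogonal summands.
\<close>

lemma isometry_join:
  fixes V W :: "'a :: {comm_ring_1, conjugatable_ring} mat"
  assumes V: "isometry_mat n r V" and W: "isometry_mat n s W"
    and orth: "adjoint_mat V * W = 0\<^sub>m r s"
  obtains U where "isometry_mat n (r + s) U"
    and "\<And>D E. D \<in> carrier_mat r r \<Longrightarrow> E \<in> carrier_mat s s \<Longrightarrow>
      U * four_block_mat D (0\<^sub>m r s) (0\<^sub>m s r) E * adjoint_mat U =
        V * D * adjoint_mat V + W * E * adjoint_mat W"
    and "U * adjoint_mat U = V * adjoint_mat V + W * adjoint_mat W"
proof -
  \<comment> \<open>Two blocks with no rows make the concatenation a block matrix, so that the product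
    formula for block matrices applies.\<close>
  define U where "U = four_block_mat V W (0\<^sub>m 0 r) (0\<^sub>m 0 s)"
  have Vc: "V \<in> carrier_mat n r" and VV: "adjoint_mat V * V = 1\<^sub>m r"
    and Wc: "W \<in> carrier_mat n s" and WW: "adjoint_mat W * W = 1\<^sub>m s"
    using V W by (auto simp: isometry_mat_def)
  have Uc: "U \<in> carrier_mat n (r + s)"
    using four_block_carrier_mat[OF Vc, of "0\<^sub>m 0 s" 0 s] by (simp add: U_def)
  have orth': "adjoint_mat W * V = 0\<^sub>m s r"
  proof -
    have "adjoint_mat W * V = adjoint_mat (adjoint_mat V * W)"
      using Vc Wc by (simp add: adjoint_mult[of _ r n _ s])
    also have "\<dots> = 0\<^sub>m s r"
      unfolding orth by (rule eq_matI) auto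
    finally show ?thesis .
  qed
  have adjU: "adjoint_mat U =
      four_block_mat (adjoint_mat V) (0\<^sub>m r 0) (adjoint_mat W) (0\<^sub>m s 0)"
  proof -
    have "adjoint_mat (0\<^sub>m 0 r) = (0\<^sub>m r 0 :: 'a mat)" "adjoint_mat (0\<^sub>m 0 s) = (0\<^sub>m s 0 :: 'a mat)"
      by (rule eq_matI; simp)+
    thus ?thesis
      unfolding U_def by (subst adjoint_four_block[OF Vc Wc zero_carrier_mat zero_carrier_mat]) simp
  qed
  have "adjoint_mat U * U = four_block_mat (1\<^sub>m r) (0\<^sub>m r s) (0\<^sub>m s r) (1\<^sub>m s)"
    unfolding adjU unfolding U_def
    using Vc Wc VV WW orth orth'
    by (subst mult_four_block_mat[of _ r n _ 0 _ s _ _ r _ s]) auto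
  hence iso: "isometry_mat n (r + s) U"
    using Uc by (simp add: isometry_mat_def)
  have conj: "U * four_block_mat D (0\<^sub>m r s) (0\<^sub>m s r) E * adjoint_mat U =
        V * D * adjoint_mat V + W * E * adjoint_mat W"
    if D: "D \<in> carrier_mat r r" and E: "E \<in> carrier_mat s s" for D E
  proof -
    have "U * four_block_mat D (0\<^sub>m r s) (0\<^sub>m s r) E =
        four_block_mat (V * D) (W * E) (0\<^sub>m 0 r) (0\<^sub>m 0 s)"
      unfolding U_def using Vc Wc D E
      by (subst mult_four_block_mat[of _ n r _ s _ 0 _ _ r _ s]) auto
    hence "U * four_block_mat D (0\<^sub>m r s) (0\<^sub>m s r) E * adjoint_mat U =
        four_block_mat (V * D * adjoint_mat V + W * E * adjoint_mat W) (0\<^sub>m n 0) (0\<^sub>m 0 n) (0\<^sub>m 0 0)"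
      unfolding adjU using Vc Wc D E
      by (simp, subst mult_four_block_mat[of _ n r _ s _ 0 _ _ n _ 0]) auto
    also have "\<dots> = V * D * adjoint_mat V + W * E * adjoint_mat W"
      by (rule eq_matI) (use Vc Wc in auto)
    finally show ?thesis .
  qed
  have "U * adjoint_mat U = V * adjoint_mat V + W * adjoint_mat W"
    using conj[of "1\<^sub>m r" "1\<^sub>m s"] Uc Vc Wc by simp
  with that iso conj show thesis
    by blast
qed

section \<open>Coefficients and orders of vanishing of power series\<close>

lemma mfps_nth_zero [simp]: "mfps_nth 0 e = 0"
  by (simp add: zero_mfps.rep_eq)

lemma mfps_nth_add [simp]: "mfps_nth (f + g) e = mfps_nth f e + mfps_nth g e"
  by (simp add: plus_mfps.rep_eq)

lemma mfps_nth_diff [simp]: "mfps_nth (f - g) e = mfps_nth f e - mfps_nth g e"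
  by (simp add: minus_mfps.rep_eq)

lemma mfps_nth_uminus [simp]: "mfps_nth (- f) e = - mfps_nth f e"
  by (simp add: uminus_mfps.rep_eq)

lemma mfps_nth_sum [simp]: "mfps_nth (sum f S) e = (\<Sum>i\<in>S. mfps_nth (f i) e)"
  by (induction S rule: infinite_finite_induct) simp_all

lemma mfps_nth_conjugate [simp]: "mfps_nth (conjugate f) e = conjugate (mfps_nth f e)"
  by (simp add: conjugate_mfps.rep_eq)

lemma tdeg_eq_0_iff [simp]: "tdeg e = 0 \<longleftrightarrow> e = 0"
  by (auto simp: tdeg_def intro: poly_mapping_eqI)

lemma tdeg_zero [simp]: "tdeg 0 = 0"
  by simp

lemma constant_term_one [simp]: "mfps_nth 1 0 = 1"
  by (simp add: one_mfps.rep_eq)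

lemma constant_term_mult [simp]:
  fixes f g :: "('a :: comm_ring_1, 'v :: finite) mfps"
  shows "mfps_nth (f * g) 0 = mfps_nth f 0 * mfps_nth g 0"
proof -
  have zero: "a = 0 \<and> b = 0" if "a + b = 0" for a b :: "'v \<Rightarrow>\<^sub>0 nat"
    using arg_cong[OF that, of tdeg] by (simp add: tdeg_add)
  have "splittings (0 :: 'v \<Rightarrow>\<^sub>0 nat) = {(0, 0)}"
    by (auto dest: zero)
  thus ?thesis
    by (simp add: mfps_nth_mult)
qed

definition mfps_const :: "'a :: comm_ring_1 \<Rightarrow> ('a, 'v) mfps" where
  "mfps_const c = Abs_mfps (\<lambda>e. if e = 0 then c else 0)"

lemma mfps_nth_const: "mfps_nth (mfps_const c) e = (if e = 0 then c else 0)"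
  by (simp add: mfps_const_def Abs_mfps_inverse)

lemma mfps_const_mult:
  "mfps_const c * mfps_const d = (mfps_const (c * d) :: ('a :: comm_ring_1, 'v) mfps)"
proof (rule mfps_eqI)
  fix e :: "'v \<Rightarrow>\<^sub>0 nat"
  have "mfps_nth (mfps_const c * mfps_const d :: ('a, 'v) mfps) e =
      (\<Sum>(a, b)\<in>splittings e \<inter> {(0, 0)}. mfps_nth (mfps_const c) a * mfps_nth (mfps_const d) b)"
    unfolding mfps_nth_mult
    by (rule sum.mono_neutral_right) (auto simp: finite_splittings mfps_nth_const split: if_splits)
  thus "mfps_nth (mfps_const c * mfps_const d :: ('a, 'v) mfps) e = mfps_nth (mfps_const (c * d)) e"
    by (cases "e = 0") (auto simp: mfps_nth_const)
qed

lemma mfps_const_one: "mfps_const 1 = 1"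
  by (rule mfps_eqI) (simp add: mfps_nth_const one_mfps.rep_eq)

text \<open>
  Membership in the power \<open>M\<^sup>d\<close> of the ideal \<open>M\<close> of the series without constant term.
\<close>

definition vanishes_below :: "nat \<Rightarrow> ('a :: comm_ring_1, 'v :: finite) mfps \<Rightarrow> bool" where
  "vanishes_below d f \<longleftrightarrow> (\<forall>e. tdeg e < d \<longrightarrow> mfps_nth f e = 0)"

lemma vanishes_below_0 [simp]: "vanishes_below 0 f" "vanishes_below d 0"
  by (simp_all add: vanishes_below_def)

lemma vanishes_below_1: "vanishes_below (Suc 0) f \<longleftrightarrow> mfps_nth f 0 = 0"
  by (auto simp: vanishes_below_def)

lemma vanishes_below_add: "vanishes_below d f \<Longrightarrow> vanishes_below d g \<Longrightarrow> vanishes_below d (f + g)"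
  by (simp add: vanishes_below_def)

lemma vanishes_below_uminus: "vanishes_below d f \<Longrightarrow> vanishes_below d (- f)"
  by (simp add: vanishes_below_def)

lemma vanishes_below_sum:
  "(\<And>i. i \<in> S \<Longrightarrow> vanishes_below d (f i)) \<Longrightarrow> vanishes_below d (sum f S)"
  by (simp add: vanishes_below_def)

lemma vanishes_below_mult:
  assumes "vanishes_below a f" "vanishes_below b g"
  shows "vanishes_below (a + b) (f * g)"
  unfolding vanishes_below_def
proof (intro allI impI)
  fix e :: "'b \<Rightarrow>\<^sub>0 nat" assume e: "tdeg e < a + b"
  have "mfps_nth f u * mfps_nth g v = 0" if "u + v = e" for u v
  proof (cases "tdeg u < a")
    case False
    hence "tdeg v < b"
      using e that tdeg_add[of u v] by simp
    thus ?thesis using assms(2) by (simp add: vanishes_below_def)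
  qed (use assms(1) in \<open>simp add: vanishes_below_def\<close>)
  thus "mfps_nth (f * g) e = 0"
    unfolding mfps_nth_mult by (intro sum.neutral) auto
qed

lemma vanishes_below_all:
  assumes "\<And>d. vanishes_below d f"
  shows "f = 0"
proof (rule mfps_eqI)
  fix e
  show "mfps_nth f e = mfps_nth 0 e"
    using assms[of "Suc (tdeg e)"] by (simp add: vanishes_below_def)
qed

text \<open>
  The power series ring is complete for the filtration by order of vanishing, so a map that improves
  agreement by one order has a fixed point. Contraction is only asked for on the series without
  constant term: squaring contracts there and not on the whole ring.
\<close>

lemma contraction_fixed_point:
  fixes \<Phi> :: "('a :: comm_ring_1, 'v :: finite) mfps \<Rightarrow> ('a, 'v) mfps"
  assumes maps: "\<And>x. vanishes_below 1 x \<Longrightarrow> vanishes_below 1 (\<Phi> x)"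
    and contracts: "\<And>x y d. vanishes_below 1 x \<Longrightarrow> vanishes_below 1 y \<Longrightarrow>
      vanishes_below d (x - y) \<Longrightarrow> vanishes_below (Suc d) (\<Phi> x - \<Phi> y)"
  obtains x where "vanishes_below 1 x" "\<Phi> x = x"
proof -
  define s where "s k = (\<Phi> ^^ k) 0" for k
  have s_Suc: "s (Suc k) = \<Phi> (s k)" for k
    by (simp add: s_def)
  have s1: "vanishes_below 1 (s k)" for k
    by (induction k) (use maps in \<open>simp_all add: s_def\<close>)
  have step: "vanishes_below k (s (Suc k) - s k)" for k
  proof (induction k)
    case (Suc k)
    show ?case
      unfolding s_Suc[of "Suc k"] by (subst s_Suc[of k]) (rule contracts[OF s1 s1 Suc])
  qed simp
  have cauchy: "vanishes_below k (s (k + j) - s k)" for k j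
  proof (induction j)
    case (Suc j)
    have "vanishes_below k (s (Suc (k + j)) - s (k + j))"
      using step[of "k + j"] by (simp add: vanishes_below_def)
    from vanishes_below_add[OF this Suc] show ?case
      by simp
  qed simp
  \<comment> \<open>The coefficients of degree \<open>d\<close> of the iterates are stationary from the iterate \<open>d + 1\<close> on.\<close>
  define x where "x = Abs_mfps (\<lambda>e. mfps_nth (s (Suc (tdeg e))) e)"
  have limit: "vanishes_below k (s k - x)" for k
    unfolding vanishes_below_def
  proof (intro allI impI)
    fix e :: "'v \<Rightarrow>\<^sub>0 nat" assume "tdeg e < k"
    then obtain j where "k = Suc (tdeg e) + j"
      using less_iff_Suc_add[of "tdeg e" k] by auto
    with cauchy[of "Suc (tdeg e)" j] show "mfps_nth (s k - x) e = 0"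
      by (simp add: x_def Abs_mfps_inverse vanishes_below_def)
  qed
  have x1: "vanishes_below 1 x"
    using vanishes_below_add[OF s1[of 1] vanishes_below_uminus[OF limit[of 1]]] by simp
  have "\<Phi> x - x = 0"
  proof (rule vanishes_below_all)
    fix d
    have "vanishes_below (Suc d) (\<Phi> x - \<Phi> (s d))"
      by (rule contracts[OF x1 s1]) (use vanishes_below_uminus[OF limit[of d]] in simp)
    from vanishes_below_add[OF this limit[of "Suc d"]]
    show "vanishes_below d (\<Phi> x - x)"
      by (simp add: s_Suc vanishes_below_def)
  qed
  with x1 that show thesis
    by simp
qed

section \<open>Inverse square roots\<close>

text \<open>
  With the factors \<open>2\<close> and \<open>4\<close> the equation for \<open>s\<close> is divisible by \<open>4\<close> and becomes the fixed point
  equation \<open>s = - (s\<^sup>2 + h + 4 h s + 4 h s\<^sup>2)\<close>, so that no division is needed in the coefficient ring.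
\<close>

lemma inverse_sqrt_of_one_plus:
  fixes h :: "('a :: comm_ring_1, 'v :: finite) mfps"
  assumes h: "mfps_nth h 0 = 0"
  obtains s where "mfps_nth s 0 = 0" "(1 + 2 * s) * (1 + 2 * s) * (1 + 4 * h) = 1"
proof -
  define \<Phi> where "\<Phi> s = - (s * s + h + 4 * h * s + 4 * h * s * s)" for s
  obtain s where s: "vanishes_below 1 s" "\<Phi> s = s"
  proof (rule contraction_fixed_point[of \<Phi>])
    fix x :: "('a, 'v) mfps" assume "vanishes_below 1 x"
    thus "vanishes_below 1 (\<Phi> x)"
      using h by (simp add: vanishes_below_1 \<Phi>_def)
  next
    fix x y :: "('a, 'v) mfps" and d
    assume x: "vanishes_below 1 x" and y: "vanishes_below 1 y" and d: "vanishes_below d (x - y)"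
    have "vanishes_below 1 (- (x + y + 4 * h + 4 * h * (x + y)))"
      using x y h by (simp add: vanishes_below_1)
    from vanishes_below_mult[OF this d]
    show "vanishes_below (Suc d) (\<Phi> x - \<Phi> y)"
      by (simp add: \<Phi>_def algebra_simps)
  qed
  have "(1 + 2 * s) * (1 + 2 * s) * (1 + 4 * h) = 1 + 4 * (s - \<Phi> s)"
    by (simp add: \<Phi>_def algebra_simps)
  with s that show thesis
    by (simp add: vanishes_below_1)
qed

text \<open>
  This is what makes normalization of vectors possible. After division by its constant term \<open>f\<close> has
  the form \<open>1 + 4 h\<close>; positivity of the constant term gives it a real square root, which makes the
  result self-adjoint.
\<close>

lemma selfadjoint_inverse_sqrt:
  fixes f :: "(complex, 'v :: finite) mfps"
  assumes selfadj: "conjugate f = f" and pos: "mfps_nth f 0 = of_real c" "c > 0"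
  obtains r where "conjugate r = r" "r * r * f = 1"
proof -
  define h where "h = mfps_const (1 / 4) * (mfps_const (1 / of_real c) * f - 1)"
  have "mfps_nth h 0 = 0"
    using pos by (simp add: h_def mfps_nth_const)
  then obtain s where s: "mfps_nth s 0 = 0" "(1 + 2 * s) * (1 + 2 * s) * (1 + 4 * h) = 1"
    by (rule inverse_sqrt_of_one_plus)
  have four: "(4 :: (complex, 'v) mfps) * mfps_const (1 / 4) = 1"
  proof -
    have "(4 :: (complex, 'v) mfps) = (mfps_const 1 + mfps_const 1) + (mfps_const 1 + mfps_const 1)"
      by (simp only: mfps_const_one) simp
    also have "\<dots> = mfps_const 4"
      by (rule mfps_eqI) (simp only: mfps_nth_add mfps_nth_const, simp)
    finally show ?thesis
      by (simp only: mfps_const_mult) (simp add: mfps_const_one)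
  qed
  have h4: "1 + 4 * h = mfps_const (1 / of_real c) * f"
    unfolding h_def by (simp add: four flip: mult.assoc)
  define r where "r = mfps_const (1 / of_real (sqrt c)) * (1 + 2 * s)"
  have "r * r * f = (mfps_const (1 / of_real (sqrt c)) * mfps_const (1 / of_real (sqrt c))) * f
      * ((1 + 2 * s) * (1 + 2 * s))"
    by (simp add: r_def algebra_simps)
  also have "\<dots> = mfps_const (1 / of_real c) * f * ((1 + 2 * s) * (1 + 2 * s))"
    using pos(2) by (simp add: mfps_const_mult flip: of_real_mult)
  also have "\<dots> = 1"
    unfolding h4[symmetric] by (subst mult.commute) (rule s(2))
  finally have r: "r * r * f = 1" .
  have r0: "mfps_nth r 0 = of_real (1 / sqrt c)"
    using s(1) by (simp add: r_def mfps_nth_const)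
  \<comment> \<open>The conjugate of \<open>r\<close> is an inverse square root as well, hence \<open>\<plusminus>r\<close>, and the sign is read
    off from the constant term.\<close>
  have "conjugate r * conjugate r * f = 1"
    using arg_cong[OF r, of conjugate] by (simp add: conjugate_dist_mul selfadj)
  hence "(conjugate r - r) * (conjugate r + r) * f = 0"
    using r by (simp add: algebra_simps)
  moreover have "f \<noteq> 0"
    using r by auto
  moreover have "mfps_nth (conjugate r + r) 0 \<noteq> 0"
    using pos(2) by (simp add: r0)
  hence "conjugate r + r \<noteq> 0"
    by (metis mfps_nth_zero)
  ultimately have "conjugate r = r"
    by simp
  with r that show thesis
    by blast
qed

section \<open>Orthonormal bases of the images of projections\<close>

text \<open>
  If the entries of \<open>P\<close> vanish to order \<open>d\<close>, then those of \<open>P = P P\<close> vanish to order \<open>d + 1\<close>; hence they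
  vanish to every order. This is Nakayama's lemma for the image of \<open>P\<close>.
\<close>

lemma idempotent_with_zero_constant_term:
  fixes P :: "('a :: comm_ring_1, 'v :: finite) mfps mat"
  assumes P: "P \<in> carrier_mat n n" "P * P = P"
    and zero: "\<And>i j. i < n \<Longrightarrow> j < n \<Longrightarrow> mfps_nth (P $$ (i, j)) 0 = 0"
  shows "P = 0\<^sub>m n n"
proof -
  have "vanishes_below d (P $$ (i, j))" if "i < n" "j < n" for d i j
    using that
  proof (induction d arbitrary: i j)
    case (Suc d)
    have "P $$ (i, j) = (P * P) $$ (i, j)"
      by (simp add: P(2))
    also have "\<dots> = (\<Sum>l<n. P $$ (i, l) * P $$ (l, j))"
      using P(1) Suc.prems by (simp add: scalar_prod_def atLeast0LessThan)
    also have "vanishes_below (Suc d) \<dots>"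
    proof (rule vanishes_below_sum)
      fix l assume "l \<in> {..<n}"
      with vanishes_below_mult[of "Suc 0" "P $$ (i, l)" d "P $$ (l, j)"] Suc zero
      show "vanishes_below (Suc d) (P $$ (i, l) * P $$ (l, j))"
        by (simp add: vanishes_below_1)
    qed
    finally show ?case .
  qed simp
  hence "P $$ (i, j) = 0" if "i < n" "j < n" for i j
    using that vanishes_below_all by blast
  thus ?thesis
    using P(1) by (intro eq_matI) auto
qed

text \<open>
  The vector is a normalized column of \<open>P\<close>. Since \<open>P = P\<^sup>* P\<close>, the squared length of column \<open>j\<close> is the
  diagonal entry \<open>f\<close> at \<open>j\<close>, and its constant term is the sum of the squared moduli of the constant
  terms in that column. Column \<open>j\<close> is chosen to contain an entry with nonzero constant term.
\<close>

lemma unit_vector_in_range: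
  fixes P :: "(complex, 'v :: finite) mfps mat"
  assumes P: "P \<in> carrier_mat n n" "adjoint_mat P = P" "P * P = P"
    and nz: "P \<noteq> 0\<^sub>m n n"
  obtains v where "isometry_mat n 1 v" "P * v = v"
proof -
  obtain i j where ij: "i < n" "j < n" "mfps_nth (P $$ (i, j)) 0 \<noteq> 0"
    using idempotent_with_zero_constant_term[OF P(1,3)] nz by blast
  define f where "f = P $$ (j, j)"
  have f: "f = (\<Sum>l<n. conjugate (P $$ (l, j)) * P $$ (l, j))"
  proof -
    have "f = (adjoint_mat P * P) $$ (j, j)"
      by (simp add: f_def P)
    thus ?thesis
      using P(1) ij(2) by (simp add: scalar_prod_def atLeast0LessThan del: assms)
  qed
  define c where "c = (\<Sum>l<n. (cmod (mfps_nth (P $$ (l, j)) 0))\<^sup>2)"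
  have "mfps_nth f 0 = of_real c"
    by (simp add: f c_def complex_norm_square mult.commute del: of_real_power)
  moreover have "c > 0"
    unfolding c_def using ij by (intro sum_pos2[of _ i]) auto
  moreover have "conjugate f = f"
  proof -
    have "conjugate f = adjoint_mat P $$ (j, j)"
      using P(1) ij(2) by (simp add: f_def)
    thus ?thesis
      by (simp add: f_def P(2))
  qed
  ultimately obtain r where r: "conjugate r = r" "r * r * f = 1"
    using selfadjoint_inverse_sqrt by metis
  define v where "v = mat n 1 (\<lambda>(l, _). r * P $$ (l, j))"
  have vc: "v \<in> carrier_mat n 1"
    by (simp add: v_def)
  have "adjoint_mat v * v = 1\<^sub>m 1"
  proof (rule eq_matI)
    fix k l :: nat assume "k < dim_row (1\<^sub>m 1 :: (complex, 'v) mfps mat)"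
      "l < dim_col (1\<^sub>m 1 :: (complex, 'v) mfps mat)"
    hence [simp]: "k = 0" "l = 0"
      by auto
    have "(adjoint_mat v * v) $$ (0, 0) =
        (\<Sum>l<n. conjugate (r * P $$ (l, j)) * (r * P $$ (l, j)))"
      by (simp add: v_def scalar_prod_def atLeast0LessThan)
    also have "\<dots> = r * r * f"
      by (simp add: f sum_distrib_left conjugate_dist_mul r(1) algebra_simps)
    finally show "(adjoint_mat v * v) $$ (k, l) = 1\<^sub>m 1 $$ (k, l)"
      by (simp add: r(2))
  qed (simp_all add: v_def)
  moreover have "P * v = v"
  proof (rule eq_matI)
    fix k l assume "k < dim_row v" "l < dim_col v"
    hence k: "k < n" and [simp]: "l = 0"
      by (auto simp: v_def)
    have "(P * v) $$ (k, 0) = (\<Sum>i<n. P $$ (k, i) * (r * P $$ (i, j)))"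
      using P(1) k by (simp add: v_def scalar_prod_def atLeast0LessThan)
    also have "\<dots> = r * (P * P) $$ (k, j)"
      using P(1) k ij(2)
      by (simp add: scalar_prod_def atLeast0LessThan sum_distrib_left algebra_simps del: assms)
    finally show "(P * v) $$ (k, l) = v $$ (k, l)"
      using k by (simp add: P(3) v_def)
  qed (use P(1) in \<open>simp_all add: v_def\<close>)
  ultimately show thesis
    using that vc by (simp add: isometry_mat_def)
qed

text \<open>
  A self-adjoint idempotent over the power series ring has an image with an orthonormal basis: unit
  vectors are split off one at a time. The induction is on a bound for the real part \<open>tr\<close> of the
  constant term of the trace, which is nonnegative on projections and drops by \<open>1\<close> at each step.
\<close>

lemma projection_isometry:
  fixes P :: "(complex, 'v :: finite) mfps mat"
  assumes "P \<in> carrier_mat n n" "adjoint_mat P = P" "P * P = P"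
  obtains r V where "isometry_mat n r V" "V * adjoint_mat V = P"
proof -
  define tr where "tr Q = (\<Sum>i<n. Re (mfps_nth (Q $$ (i, i)) 0))"
    for Q :: "(complex, 'v) mfps mat"
  have "\<exists>r V. isometry_mat n r V \<and> V * adjoint_mat V = P" if "tr P < real m" for m
    using assms that
  proof (induction m arbitrary: P)
    case (0 P)
    have "Re (mfps_nth (P $$ (i, i)) 0) \<ge> 0" if i: "i < n" for i
    proof -
      have "P $$ (i, i) = (adjoint_mat P * P) $$ (i, i)"
        by (simp add: 0)
      also have "\<dots> = (\<Sum>l<n. conjugate (P $$ (l, i)) * P $$ (l, i))"
        using 0(1) i by (simp add: scalar_prod_def atLeast0LessThan del: 0)
      finally have *: "P $$ (i, i) = (\<Sum>l<n. conjugate (P $$ (l, i)) * P $$ (l, i))" .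
      show ?thesis
        unfolding * by (simp add: sum_nonneg)
    qed
    hence "tr P \<ge> 0"
      unfolding tr_def by (intro sum_nonneg) auto
    with 0 show ?case
      by simp
  next
    case (Suc m P)
    note Pc = Suc.prems(1) and P = Suc.prems(2,3)
    show ?case
    proof (cases "P = 0\<^sub>m n n")
      case True
      have "isometry_mat n 0 (0\<^sub>m n 0 :: (complex, 'v) mfps mat)"
        by (auto simp: isometry_mat_def)
      moreover have "0\<^sub>m n 0 * adjoint_mat (0\<^sub>m n 0) = P"
        unfolding True by (rule eq_matI) (auto simp: scalar_prod_def)
      ultimately show ?thesis
        by blast
    next
      case False
      then obtain v where v: "isometry_mat n 1 v" and Pv: "P * v = v"
        using unit_vector_in_range[OF Pc P] by blast
      have vc: "v \<in> carrier_mat n 1" and av: "adjoint_mat v \<in> carrier_mat 1 n"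
        using v by (auto simp: isometry_mat_def)
      define Q where "Q = v * adjoint_mat v"
      have Qc: "Q \<in> carrier_mat n n"
        using vc by (auto simp: Q_def)
      have adjQ: "adjoint_mat Q = Q"
        using vc by (simp add: Q_def adjoint_mult[OF vc av])
      have PQ: "P * Q = Q"
        unfolding Q_def by (simp add: Pv flip: assoc_mult_mat[OF Pc vc av])
      have QP: "Q * P = Q"
        using arg_cong[OF PQ, of adjoint_mat] adjoint_mult[OF Pc Qc] by (simp add: adjQ P(1))
      have Qv: "Q * v = v"
        unfolding Q_def by (rule isometry_absorb[OF v])
      have QQ: "Q * Q = Q"
        using assoc_mult_mat[OF Qc vc av] by (simp add: Qv flip: Q_def)
      have "tr Q = Re (mfps_nth ((adjoint_mat v * v) $$ (0, 0)) 0)"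
        using vc by (simp add: tr_def Q_def scalar_prod_def mult.commute atLeast0LessThan)
      also have "\<dots> = 1"
        using v by (simp add: isometry_mat_def)
      finally have trQ: "tr Q = 1" .
      have "tr (P - Q) = tr P - tr Q"
        using Pc Qc by (simp add: tr_def sum_subtractf)
      hence "tr (P - Q) < real m"
        using trQ Suc.prems(4) by simp
      moreover have "adjoint_mat (P - Q) = P - Q"
        using Pc Qc by (simp add: adjoint_minus adjQ P(1))
      moreover have "(P - Q) * (P - Q) = P - Q"
        using minus_mult_distrib_mat[OF Pc Qc, of "P - Q" n]
          mult_minus_distrib_mat[OF Pc Pc Qc] mult_minus_distrib_mat[OF Qc Pc Qc] Pc Qc
        by (simp add: P(2) PQ QP QQ minus_carrier_mat) (rule eq_matI; simp)
      ultimately obtain r V where V: "isometry_mat n r V" and VV: "V * adjoint_mat V = P - Q"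
        using Suc.IH[of "P - Q"] Pc Qc by (auto simp: minus_carrier_mat)
      have Vc: "V \<in> carrier_mat n r" "adjoint_mat V \<in> carrier_mat r n"
        using V by (auto simp: isometry_mat_def)
      \<comment> \<open>The basis of the image of \<open>P - Q\<close> is orthogonal to \<open>v\<close>, because \<open>P - Q\<close> kills \<open>v\<close>.\<close>
      have "adjoint_mat V * v = adjoint_mat V * (P - Q) * v"
        using isometry_absorb(2)[OF V] by (simp add: VV)
      also have "\<dots> = adjoint_mat V * (P * v - Q * v)"
        using assoc_mult_mat[OF Vc(2), of "P - Q" n v 1] minus_mult_distrib_mat[OF Pc Qc vc] vc Qc
        by (simp add: minus_carrier_mat)
      also have "\<dots> = adjoint_mat V * 0\<^sub>m n 1"
        using vc by (simp add: Pv Qv)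
      also have "\<dots> = 0\<^sub>m r 1"
        using Vc by simp
      finally obtain U where "isometry_mat n (r + 1) U" "U * adjoint_mat U = P - Q + Q"
        using isometry_join[OF V v] by (metis VV Q_def)
      moreover have "P - Q + Q = P"
        using Pc Qc by (intro eq_matI) auto
      ultimately show ?thesis
        by auto
    qed
  qed
  moreover obtain m where "tr P < real m"
    using reals_Archimedean2 by blast
  ultimately show thesis
    using that by blast
qed

section \<open>From orthogonal projections to a unitary diagonalization\<close>

text \<open>
  Both \<open>n\<close> and \<open>r\<close> are the trace of \<open>V V\<^sup>*\<close>, which is also that of \<open>V\<^sup>* V\<close>; the equality of the series
  \<open>n\<close> and \<open>r\<close> gives that of the numbers because the coefficients have characteristic zero.
\<close>

lemma isometry_onto_is_square:
  fixes V :: "(complex, 'v :: finite) mfps mat"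
  assumes V: "isometry_mat n r V" and onto: "V * adjoint_mat V = 1\<^sub>m n"
  shows "r = n"
proof -
  have Vc: "V \<in> carrier_mat n r"
    by (rule isometry_mat_carrier[OF V])
  have "of_nat n = (\<Sum>i<n. (V * adjoint_mat V) $$ (i, i))"
    by (simp add: onto)
  also have "\<dots> = (\<Sum>i<n. \<Sum>k<r. V $$ (i, k) * conjugate (V $$ (i, k)))"
    using Vc by (simp add: scalar_prod_def atLeast0LessThan)
  also have "\<dots> = (\<Sum>k<r. \<Sum>i<n. V $$ (i, k) * conjugate (V $$ (i, k)))"
    by (rule sum.swap)
  also have "\<dots> = (\<Sum>k<r. (adjoint_mat V * V) $$ (k, k))"
    using Vc by (simp add: scalar_prod_def atLeast0LessThan mult.commute)
  also have "\<dots> = of_nat r"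
    using V by (simp add: isometry_mat_def)
  finally have "mfps_nth (of_nat n :: (complex, 'v) mfps) 0 = mfps_nth (of_nat r :: (complex, 'v) mfps) 0"
    by simp
  moreover have "mfps_nth (of_nat k :: (complex, 'v) mfps) 0 = of_nat k" for k
    by (induction k) simp_all
  ultimately show ?thesis
    by simp
qed

text \<open>
  The orthonormal bases of the images of the \<open>P k\<close> are concatenated one after the other, and \<open>D\<close>
  repeats each \<open>mu k\<close> as often as the basis of its summand requires. The induction on \<open>K\<close>
  runs over partial sums of the projections, for which \<open>V\<close> is in general not square.
\<close>

lemma orthogonal_projections_diagonalization:
  fixes n :: nat and P :: "'k \<Rightarrow> (complex, 'v :: finite) mfps mat"
  defines "R \<equiv> ring_mat TYPE((complex, 'v) mfps) n ()"
  assumes "finite K"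
    and "\<And>k. k \<in> K \<Longrightarrow> P k \<in> carrier_mat n n"
    and "\<And>k. k \<in> K \<Longrightarrow> adjoint_mat (P k) = P k"
    and "\<And>k. k \<in> K \<Longrightarrow> P k * P k = P k"
    and "\<And>k k'. k \<in> K \<Longrightarrow> k' \<in> K \<Longrightarrow> k \<noteq> k' \<Longrightarrow> P k * P k' = 0\<^sub>m n n"
  obtains r V D where "isometry_mat n r V" "D \<in> carrier_mat r r" "diagonal_mat D"
    "V * adjoint_mat V = finsum R P K"
    "V * D * adjoint_mat V = finsum R (\<lambda>k. mu k \<cdot>\<^sub>m P k) K"
proof -
  interpret R: ring R
    unfolding R_def by (rule ring_mat)
  have R_simps: "carrier R = carrier_mat n n" "mult R = (*)" "add R = (+)" "zero R = 0\<^sub>m n n"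
    by (simp_all add: R_def ring_mat_simps)
  have "\<exists>r V D. isometry_mat n r V \<and> D \<in> carrier_mat r r \<and> diagonal_mat D \<and>
    V * adjoint_mat V = finsum R P K \<and>
    V * D * adjoint_mat V = finsum R (\<lambda>k. mu k \<cdot>\<^sub>m P k) K"
    using assms(2-)
  proof (induction K rule: finite_induct)
    case empty
    have "isometry_mat n 0 (0\<^sub>m n 0 :: (complex, 'v) mfps mat)"
      by (auto simp: isometry_mat_def)
    moreover have "(0\<^sub>m 0 0 :: (complex, 'v) mfps mat) \<in> carrier_mat 0 0"
      "diagonal_mat (0\<^sub>m 0 0 :: (complex, 'v) mfps mat)"
      by (auto simp: diagonal_mat_def)
    moreover have "0\<^sub>m n 0 * adjoint_mat (0\<^sub>m n 0) = (0\<^sub>m n n :: (complex, 'v) mfps mat)"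
      "0\<^sub>m n 0 * 0\<^sub>m 0 0 * adjoint_mat (0\<^sub>m n 0) = (0\<^sub>m n n :: (complex, 'v) mfps mat)"
      by (rule eq_matI; simp add: scalar_prod_def)+
    ultimately show ?case
      unfolding R.finsum_empty R_simps by blast
  next
    case (insert k K)
    note Pc = insert.prems(1)
    have Pk: "P k \<in> carrier_mat n n" "adjoint_mat (P k) = P k" "P k * P k = P k"
      using insert.prems by auto
    obtain r V D where V: "isometry_mat n r V" and D: "D \<in> carrier_mat r r" "diagonal_mat D"
      and VV: "V * adjoint_mat V = finsum R P K"
      and VDV: "V * D * adjoint_mat V = finsum R (\<lambda>k. mu k \<cdot>\<^sub>m P k) K"
      using insert.IH insert.prems by auto
    obtain s W where W: "isometry_mat n s W" and WW: "W * adjoint_mat W = P k"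
      using projection_isometry[OF Pk] by blast
    have Vc: "V \<in> carrier_mat n r" "adjoint_mat V \<in> carrier_mat r n"
      and Wc: "W \<in> carrier_mat n s" "adjoint_mat W \<in> carrier_mat s n"
      using V W by (auto simp: isometry_mat_def)
    have Sc: "finsum R P K \<in> carrier_mat n n"
      using R.finsum_closed[of P K] Pc by (auto simp: R_simps)
    have "finsum R P K * P k = finsum R (\<lambda>j. P j * P k) K"
      using R.finsum_ldistr[of K "P k" P] insert.hyps(1) Pc by (auto simp: R_simps)
    also have "\<dots> = finsum R (\<lambda>j. \<zero>\<^bsub>R\<^esub>) K"
      using insert.hyps(2) insert.prems(4)[of _ k]
      by (intro R.finsum_cong') (auto simp: R_simps)
    also have "\<dots> = 0\<^sub>m n n"
      by (simp add: R_simps(4) R.finsum_zero[unfolded R_simps])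
    finally have SP: "finsum R P K * P k = 0\<^sub>m n n" .
    \<comment> \<open>The old columns lie in the image of the partial sum and the new ones in that of \<open>P k\<close>.\<close>
    have "adjoint_mat V * W = adjoint_mat V * finsum R P K * (P k * W)"
      using isometry_absorb(2)[OF V] isometry_absorb(1)[OF W] by (simp add: VV WW)
    also have "\<dots> = adjoint_mat V * (finsum R P K * P k) * W"
      using Vc Wc Sc Pk
      by (simp add: assoc_mult_mat[of _ r n _ n _ s] assoc_mult_mat[of _ n n _ n _ s]
          mult_carrier_mat[of _ n n] mult_carrier_mat[of _ n n _ s])
    also have "\<dots> = 0\<^sub>m r s"
      using Vc Wc by (simp add: SP)
    finally obtain U where U: "isometry_mat n (r + s) U"
      and conj: "\<And>D E. D \<in> carrier_mat r r \<Longrightarrow> E \<in> carrier_mat s s \<Longrightarrow>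
        U * four_block_mat D (0\<^sub>m r s) (0\<^sub>m s r) E * adjoint_mat U =
          V * D * adjoint_mat V + W * E * adjoint_mat W"
      and UU: "U * adjoint_mat U = finsum R P K + P k"
      using isometry_join[OF V W] by (metis VV WW)
    define E where "E = four_block_mat D (0\<^sub>m r s) (0\<^sub>m s r) (mu k \<cdot>\<^sub>m 1\<^sub>m s)"
    have "E \<in> carrier_mat (r + s) (r + s)" "diagonal_mat E"
      using D by (auto simp: E_def diagonal_mat_def)
    moreover have "finsum R P (insert k K) = finsum R P K + P k"
      using R.finsum_insert[of K k P] insert.hyps Pc Sc Pk
      by (auto simp: R_simps comm_add_mat[of _ n n])
    moreover have "U * E * adjoint_mat U = finsum R (\<lambda>k. mu k \<cdot>\<^sub>m P k) (insert k K)"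
    proof -
      have "W * (mu k \<cdot>\<^sub>m 1\<^sub>m s) * adjoint_mat W = mu k \<cdot>\<^sub>m P k"
        using Wc WW by (simp add: mult_smult_distrib[of _ n s _ s] mult_smult_assoc_mat[of _ n s _ n])
      hence "U * E * adjoint_mat U = finsum R (\<lambda>k. mu k \<cdot>\<^sub>m P k) K + mu k \<cdot>\<^sub>m P k"
        unfolding E_def by (subst conj) (use D in \<open>auto simp: VDV\<close>)
      moreover have "finsum R (\<lambda>k. mu k \<cdot>\<^sub>m P k) K \<in> carrier_mat n n"
        using R.finsum_closed[of "\<lambda>k. mu k \<cdot>\<^sub>m P k" K] Pc by (auto simp: R_simps)
      ultimately show ?thesis
        using R.finsum_insert[of K k "\<lambda>k. mu k \<cdot>\<^sub>m P k"] insert.hyps Pc Pk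
        by (auto simp: R_simps comm_add_mat[of _ n n])
    qed
    ultimately show ?case
      using U UU by auto
  qed
  thus thesis
    using that by blast
qed

lemma unitarily_diagonalizable_if_spectral:
  fixes A :: "(complex, 'v :: finite) mfps mat" and n :: nat and P :: "'k \<Rightarrow> (complex, 'v) mfps mat"
  defines "R \<equiv> ring_mat TYPE((complex, 'v) mfps) n ()"
  assumes "finite K"
    and "\<And>k. k \<in> K \<Longrightarrow> P k \<in> carrier_mat n n"
    and "\<And>k. k \<in> K \<Longrightarrow> adjoint_mat (P k) = P k"
    and "\<And>k. k \<in> K \<Longrightarrow> P k * P k = P k"
    and "\<And>k k'. k \<in> K \<Longrightarrow> k' \<in> K \<Longrightarrow> k \<noteq> k' \<Longrightarrow> P k * P k' = 0\<^sub>m n n"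
    and "finsum R P K = 1\<^sub>m n"
    and "A = finsum R (\<lambda>k. mu k \<cdot>\<^sub>m P k) K"
  shows "unitarily_diagonalizable n A"
proof -
  obtain r V D where V: "isometry_mat n r V" "D \<in> carrier_mat r r" "diagonal_mat D"
    "V * adjoint_mat V = finsum R P K"
    "V * D * adjoint_mat V = finsum R (\<lambda>k. mu k \<cdot>\<^sub>m P k) K"
    using orthogonal_projections_diagonalization[where n = n and P = P and K = K and mu = mu, OF assms(2-6)]
    unfolding R_def by blast
  have "r = n"
    using isometry_onto_is_square V(1,4) assms(7) by metis
  hence "unitary_mat n V" "D \<in> carrier_mat n n" "A = V * D * adjoint_mat V"
    using V assms(7,8) by (auto simp: unitary_mat_def isometry_mat_def)
  with V(3) show ?thesis
    unfolding unitarily_diagonalizable_def by blast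
qed

section \<open>From a unitary diagonalization to orthogonal projections\<close>

lemma index_finsum_ring_mat:
  fixes F :: "'k \<Rightarrow> 'a :: comm_ring_1 mat"
  assumes "finite K" "\<And>k. k \<in> K \<Longrightarrow> F k \<in> carrier_mat n n" "i < n" "j < n"
  shows "finsum (ring_mat TYPE('a) n ()) F K $$ (i, j) = (\<Sum>k\<in>K. F k $$ (i, j))"
proof -
  interpret R: ring "ring_mat TYPE('a) n ()"
    by (rule ring_mat)
  show ?thesis
    using assms
  proof (induction K rule: finite_induct)
    case empty
    show ?case
      unfolding R.finsum_empty using empty by (simp add: ring_mat_simps)
  next
    case (insert k K)
    have "finsum (ring_mat TYPE('a) n ()) F K \<in> carrier_mat n n"
      using R.finsum_closed[of F K] insert.prems by (auto simp: ring_mat_simps)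
    with insert R.finsum_insert[of K k F] show ?case
      by (auto simp: ring_mat_simps)
  qed
qed

lemma unitary_conjugation_mult:
  fixes U E F :: "'a :: {comm_ring_1, conjugatable_ring} mat"
  assumes U: "unitary_mat n U" and E: "E \<in> carrier_mat n n" "F \<in> carrier_mat n n"
  shows "(U * E * adjoint_mat U) * (U * F * adjoint_mat U) = U * (E * F) * adjoint_mat U"
proof -
  have Uc: "U \<in> carrier_mat n n" "adjoint_mat U \<in> carrier_mat n n" and UU: "adjoint_mat U * U = 1\<^sub>m n"
    using U by (auto simp: unitary_mat_def)
  have "(U * E * adjoint_mat U) * (U * F * adjoint_mat U) =
      U * (E * ((adjoint_mat U * U) * (F * adjoint_mat U)))"
    using Uc E by (simp add: assoc_mult_mat[of _ n n _ n _ n] mult_carrier_mat[of _ n n _ n])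
  also have "\<dots> = U * (E * F) * adjoint_mat U"
    using Uc E left_mult_one_mat[of "F * adjoint_mat U" n n] by (simp add: UU assoc_mult_mat[of _ n n _ n _ n] mult_carrier_mat[of _ n n _ n])
  finally show ?thesis .
qed

lemma finsum_unitary_conjugation:
  fixes U :: "'a :: {comm_ring_1, conjugatable_ring} mat"
  assumes U: "U \<in> carrier_mat n n" and K: "finite K" "\<And>k. k \<in> K \<Longrightarrow> F k \<in> carrier_mat n n"
  shows "finsum (ring_mat TYPE('a) n ()) (\<lambda>k. U * F k * adjoint_mat U) K =
    U * finsum (ring_mat TYPE('a) n ()) F K * adjoint_mat U"
proof -
  interpret R: ring "ring_mat TYPE('a) n ()"
    by (rule ring_mat)
  note simps = ring_mat_simps
  have "U * finsum (ring_mat TYPE('a) n ()) F K = finsum (ring_mat TYPE('a) n ()) (\<lambda>k. U * F k) K"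
    using R.finsum_rdistr[of K U F] assms by (auto simp: simps)
  thus ?thesis
    using R.finsum_ldistr[of K "adjoint_mat U" "\<lambda>k. U * F k"] assms by (auto simp: simps)
qed

lemma char_poly_unitary_conjugate:
  assumes "unitary_mat n U" "D \<in> carrier_mat n n" "diagonal_mat D"
  shows "char_poly (U * D * adjoint_mat U) = (\<Prod>a\<leftarrow>diag_mat D. [:- a, 1:])"
proof -
  have "similar_mat (U * D * adjoint_mat U) D"
    using assms by (intro similar_matI[of _ _ U "adjoint_mat U" n]) (auto simp: unitary_mat_def)
  moreover have "upper_triangular D"
    using assms(2,3) by (auto simp: diagonal_mat_def upper_triangular_def)
  ultimately show ?thesis
    using char_poly_similar char_poly_upper_triangular[OF assms(2)] by metis
qed

lemma to_closure_eq_iff [simp]: "to_closure x = to_closure y \<longleftrightarrow> x = y"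
  by (simp add: to_closure_def)

lemma closure_eigenvalues_of_split:
  assumes "char_poly A = (\<Prod>a\<leftarrow>as. [:- a, 1:])"
  shows "closure_eigenvalues A = to_closure ` set as"
proof -
  interpret comm_ring_hom to_closure
    by unfold_locales (simp_all add: to_closure_def)
  interpret map_poly: map_poly_comm_ring_hom to_closure ..
  have "map_poly to_closure (\<Prod>a\<leftarrow>as. [:- a, 1:]) = (\<Prod>a\<leftarrow>as. [:- to_closure a, 1:])"
    by (induction as) (simp_all add: hom_distribs)
  moreover have "poly (\<Prod>a\<leftarrow>as. [:- to_closure a, 1:]) x = 0 \<longleftrightarrow> x \<in> to_closure ` set as" for x
    by (induction as) auto
  ultimately show ?thesis
    by (simp add: closure_eigenvalues_def assms)
qed

text \<open>
  Every diagonal entry of \<open>D\<close> is \<open>mu k\<close> for exactly one \<open>k\<close>. Hence the \<open>0\<close>-\<open>1\<close> matrices \<open>E k\<close> that mark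
  the positions of \<open>mu k\<close> are orthogonal idempotents with \<open>\<Sum> E k = 1\<close> and \<open>\<Sum> mu k E k = D\<close>, and
  conjugation by \<open>U\<close> preserves these relations.
\<close>

lemma spectral_if_unitarily_diagonalizable:
  fixes U D :: "('a :: {comm_ring_1, conjugatable_ring}) mat" and n :: nat and mu :: "'k \<Rightarrow> 'a"
  defines "R \<equiv> ring_mat TYPE('a) n ()"
  assumes U: "unitary_mat n U" and D: "D \<in> carrier_mat n n" "diagonal_mat D"
    and K: "finite K" and mu: "inj_on mu K" "mu ` K = set (diag_mat D)"
  obtains P where "\<forall>k\<in>K. P k \<in> carrier_mat n n"
    "\<forall>k\<in>K. adjoint_mat (P k) = P k"
    "\<forall>k\<in>K. P k * P k = P k"
    "finsum R P K = 1\<^sub>m n"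
    "\<forall>k\<in>K. \<forall>k'\<in>K. k \<noteq> k' \<longrightarrow> P k * P k' = 0\<^sub>m n n"
    "U * D * adjoint_mat U = finsum R (\<lambda>k. mu k \<cdot>\<^sub>m P k) K"
proof -
  interpret R: ring R
    unfolding R_def by (rule ring_mat)
  define E where "E k = mat n n (\<lambda>(i, j). if i = j \<and> D $$ (i, i) = mu k then 1 else 0 :: 'a)" for k
  define P where "P k = U * E k * adjoint_mat U" for k
  have Uc: "U \<in> carrier_mat n n" "adjoint_mat U \<in> carrier_mat n n" and UU: "U * adjoint_mat U = 1\<^sub>m n"
    using U by (auto simp: unitary_mat_def)
  have Ec: "E k \<in> carrier_mat n n" for k
    by (simp add: E_def)
  have EE: "E k * E k' = (if k = k' then E k else 0\<^sub>m n n)" if "k \<in> K" "k' \<in> K" for k k'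
  proof (rule eq_matI)
    fix i j
    assume "i < dim_row (if k = k' then E k else 0\<^sub>m n n)" "j < dim_col (if k = k' then E k else 0\<^sub>m n n)"
    hence ij: "i < n" "j < n"
      by (auto simp: E_def split: if_splits)
    have "(E k * E k') $$ (i, j) = (\<Sum>l<n. E k $$ (i, l) * E k' $$ (l, j))"
      using ij Ec[of k] Ec[of k'] by (simp add: scalar_prod_def atLeast0LessThan)
    also have "\<dots> = (\<Sum>l<n. if l = i then E k $$ (i, i) * E k' $$ (i, j) else 0)"
      using ij by (intro sum.cong) (auto simp: E_def)
    also have "\<dots> = E k $$ (i, i) * E k' $$ (i, j)"
      using ij by simp
    also have "\<dots> = (if k = k' then E k else 0\<^sub>m n n) $$ (i, j)"
      using ij that inj_onD[OF mu(1), of k k'] by (auto simp: E_def)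
    finally show "(E k * E k') $$ (i, j) = (if k = k' then E k else 0\<^sub>m n n) $$ (i, j)" .
  qed (auto simp: E_def)
  have diag: "\<exists>k\<in>K. D $$ (i, i) = mu k" if "i < n" for i
  proof -
    have "D $$ (i, i) \<in> set (diag_mat D)"
      using that D(1) by (auto simp: diag_mat_def)
    thus ?thesis
      using mu(2) by auto
  qed
  \<comment> \<open>Used with \<open>c = 1\<close> for the sum of the \<open>E k\<close> and with \<open>c = mu\<close> for \<open>D\<close>.\<close>
  have weighted: "(\<Sum>k\<in>K. c k * E k $$ (i, j)) = (if i = j then c (the_inv_into K mu (D $$ (i, i))) else 0)"
    if ij: "i < n" "j < n" for i j and c :: "'k \<Rightarrow> 'a"
  proof -
    obtain k where k: "k \<in> K" "D $$ (i, i) = mu k"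
      using diag ij by blast
    have "(\<Sum>l\<in>K. c l * E l $$ (i, j)) = (\<Sum>l\<in>K. if l = k then (if i = j then c k else 0) else 0)"
      using ij k inj_onD[OF mu(1), of k] by (intro sum.cong) (auto simp: E_def)
    thus ?thesis
      using K k the_inv_into_f_f[OF mu(1) k(1)] by auto
  qed
  have Ec': "mu k \<cdot>\<^sub>m E k \<in> carrier_mat n n" for k
    using Ec[of k] by simp
  have carr: "finsum R F K \<in> carrier_mat n n" if "\<And>k. F k \<in> carrier_mat n n" for F
    using R.finsum_closed[of F K] that by (auto simp: R_def ring_mat_simps)
  have sumE: "finsum R E K = 1\<^sub>m n"
  proof (rule eq_matI)
    fix i j assume "i < dim_row (1\<^sub>m n :: 'a mat)" "j < dim_col (1\<^sub>m n :: 'a mat)"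
    hence ij: "i < n" "j < n"
      by auto
    have "finsum R E K $$ (i, j) = (\<Sum>k\<in>K. E k $$ (i, j))"
      unfolding R_def by (rule index_finsum_ring_mat[OF K Ec ij])
    with ij weighted[of i j "\<lambda>_. 1"] show "finsum R E K $$ (i, j) = 1\<^sub>m n $$ (i, j)"
      by simp
  qed (use carr[of E] Ec in auto)
  have sumD: "finsum R (\<lambda>k. mu k \<cdot>\<^sub>m E k) K = D"
  proof (rule eq_matI)
    fix i j assume "i < dim_row D" "j < dim_col D"
    hence ij: "i < n" "j < n"
      using D by auto
    have "finsum R (\<lambda>k. mu k \<cdot>\<^sub>m E k) K $$ (i, j) = (\<Sum>k\<in>K. (mu k \<cdot>\<^sub>m E k) $$ (i, j))"
      unfolding R_def by (rule index_finsum_ring_mat[OF K Ec' ij])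
    also have "\<dots> = (\<Sum>k\<in>K. mu k * E k $$ (i, j))"
      using ij by (simp add: E_def)
    also have "\<dots> = D $$ (i, j)"
      using ij weighted[of i j mu] diag[of i] D mu(1)
      by (auto simp: diagonal_mat_def the_inv_into_f_f)
    finally show "finsum R (\<lambda>k. mu k \<cdot>\<^sub>m E k) K $$ (i, j) = D $$ (i, j)" .
  qed (use carr[of "\<lambda>k. mu k \<cdot>\<^sub>m E k"] Ec' D in auto)
  show thesis
  proof (rule that)
    show "\<forall>k\<in>K. P k \<in> carrier_mat n n"
      using Uc Ec by (auto simp: P_def)
    have "adjoint_mat (P k) = P k" for k
    proof -
      have "adjoint_mat (E k) = E k"
        by (rule eq_matI) (auto simp: E_def)
      thus ?thesis
        using Uc Ec[of k] by (simp add: P_def adjoint_mult[of _ n n _ n] mult_carrier_mat[of _ n n _ n]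
            assoc_mult_mat[of _ n n _ n _ n])
    qed
    thus "\<forall>k\<in>K. adjoint_mat (P k) = P k"
      by blast
    show "\<forall>k\<in>K. P k * P k = P k"
      by (simp add: P_def unitary_conjugation_mult[OF U Ec Ec] EE)
    show "\<forall>k\<in>K. \<forall>k'\<in>K. k \<noteq> k' \<longrightarrow> P k * P k' = 0\<^sub>m n n"
      using Uc by (simp add: P_def unitary_conjugation_mult[OF U Ec Ec] EE)
    show "finsum R P K = 1\<^sub>m n"
      using finsum_unitary_conjugation[OF Uc(1) K Ec, folded R_def] Uc(1)
      unfolding P_def by (simp add: sumE UU)
    have "mu k \<cdot>\<^sub>m P k = U * (mu k \<cdot>\<^sub>m E k) * adjoint_mat U" for k
      using Uc Ec[of k] mult_carrier_mat[OF Uc(1) Ec[of k]]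
      by (simp add: P_def mult_smult_distrib[of _ n n _ n] mult_smult_assoc_mat[of _ n n _ n])
    thus "U * D * adjoint_mat U = finsum R (\<lambda>k. mu k \<cdot>\<^sub>m P k) K"
      using finsum_unitary_conjugation[OF Uc(1) K Ec', folded R_def] by (simp add: sumD)
  qed
qed

section \<open>The spectral theorem\<close>

theorem theorem1:
  fixes A :: "(complex, 'm :: finite) mfps mat"
    and n d :: nat
    and lam :: "nat \<Rightarrow> (complex, 'm) mfps fract alg_closure"
  assumes "A \<in> carrier_mat n n"
    and "normal_mat A"
    and "inj_on lam {1..d}"
    and "lam ` {1..d} = closure_eigenvalues A"
  shows "unitarily_diagonalizable n A \<longleftrightarrow>
    (\<exists>as. char_poly A = (\<Prod>a\<leftarrow>as. [:- a, 1:])) \<and>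
    (\<exists>mu :: nat \<Rightarrow> (complex, 'm) mfps. \<exists>P :: nat \<Rightarrow> (complex, 'm) mfps mat.
       (\<forall>k\<in>{1..d}. to_closure (mu k) = lam k) \<and>
       (\<forall>k\<in>{1..d}. P k \<in> carrier_mat n n) \<and>
       (\<forall>k\<in>{1..d}. adjoint_mat (P k) = P k) \<and>
       (\<forall>k\<in>{1..d}. P k * P k = P k) \<and>
       finsum (ring_mat TYPE((complex, 'm) mfps) n ()) P {1..d} = 1\<^sub>m n \<and>
       (\<forall>k\<in>{1..d}. \<forall>k'\<in>{1..d}. k \<noteq> k' \<longrightarrow> P k * P k' = 0\<^sub>m n n) \<and>
       A = finsum (ring_mat TYPE((complex, 'm) mfps) n ()) (\<lambda>k. mu k \<cdot>\<^sub>m P k) {1..d})"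
  (is "_ \<longleftrightarrow> ?splits \<and> ?spectral")
proof
  assume "unitarily_diagonalizable n A"
  then obtain U D where U: "unitary_mat n U" and D: "D \<in> carrier_mat n n" "diagonal_mat D"
    and A: "A = U * D * adjoint_mat U"
    by (auto simp: unitarily_diagonalizable_def)
  have splits: "char_poly A = (\<Prod>a\<leftarrow>diag_mat D. [:- a, 1:])"
    unfolding A by (rule char_poly_unitary_conjugate[OF U D])
  have ev: "lam ` {1..d} = to_closure ` set (diag_mat D)"
    using assms(4) closure_eigenvalues_of_split[OF splits] by simp
  \<comment> \<open>The eigenvalues are diagonal entries of \<open>D\<close>, so they have preimages in the power series ring.\<close>
  define mu where "mu k = (SOME a. to_closure a = lam k)" for k
  have mu: "to_closure (mu k) = lam k" if "k \<in> {1..d}" for k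
  proof -
    have "\<exists>a. to_closure a = lam k"
      using that ev by (metis imageE imageI)
    thus ?thesis
      unfolding mu_def by (rule someI_ex)
  qed
  have mu_inj: "inj_on mu {1..d}"
    using assms(3) mu by (metis inj_on_def)
  have mu_image: "mu ` {1..d} = set (diag_mat D)"
  proof -
    have "to_closure ` mu ` {1..d} = to_closure ` set (diag_mat D)"
      unfolding ev[symmetric] image_image using mu by (intro image_cong) auto
    thus ?thesis
      by (subst (asm) inj_image_eq_iff) (auto simp: inj_def)
  qed
  obtain P where "\<forall>k\<in>{1..d}. P k \<in> carrier_mat n n"
    "\<forall>k\<in>{1..d}. adjoint_mat (P k) = P k"
    "\<forall>k\<in>{1..d}. P k * P k = P k"
    "finsum (ring_mat TYPE((complex, 'm) mfps) n ()) P {1..d} = 1\<^sub>m n"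
    "\<forall>k\<in>{1..d}. \<forall>k'\<in>{1..d}. k \<noteq> k' \<longrightarrow> P k * P k' = 0\<^sub>m n n"
    "A = finsum (ring_mat TYPE((complex, 'm) mfps) n ()) (\<lambda>k. mu k \<cdot>\<^sub>m P k) {1..d}"
    by (rule spectral_if_unitarily_diagonalizable[OF U D finite_atLeastAtMost mu_inj mu_image,
          folded A])
  with mu have ?spectral
    by blast
  with splits show "?splits \<and> ?spectral"
    by blast
next
  assume "?splits \<and> ?spectral"
  then obtain mu P where "\<forall>k\<in>{1..d}. P k \<in> carrier_mat n n"
    "\<forall>k\<in>{1..d}. adjoint_mat (P k) = P k" "\<forall>k\<in>{1..d}. P k * P k = P k"
    "\<forall>k\<in>{1..d}. \<forall>k'\<in>{1..d}. k \<noteq> k' \<longrightarrow> P k * P k' = 0\<^sub>m n n"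
    "finsum (ring_mat TYPE((complex, 'm) mfps) n ()) P {1..d} = 1\<^sub>m n"
    "A = finsum (ring_mat TYPE((complex, 'm) mfps) n ()) (\<lambda>k. mu k \<cdot>\<^sub>m P k) {1..d}"
    by (elim conjE exE) blast
  thus "unitarily_diagonalizable n A"
    by (intro unitarily_diagonalizable_if_spectral[of "{1..d}" P n A mu]) auto
qed

end
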